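(* Let $L\phi=\phi'$ and $M\phi=\phi-\phi''$ with $\operatorname{Dom}L=\operatorname{Dom}M=\{\phi\in\mathcal S[0,\infty):\phi(0)=0\}$, and let $F,F^{-1}$ be the transforms defined in the context. There exist remainder transforms $R_L,R_M$ (each assigning to every $\phi\in\operatorname{Dom}L=\operatorname{Dom}M$ a function on $\mathbb R\cup\mathcal C$) for which, for all $\lambda\in\mathbb R\cup\mathcal C$ and all $\phi\in\operatorname{Dom}L=\operatorname{Dom}M$, $$F[L\phi](\lambda)=\omega_L(\lambda)F[\phi](\lambda)+R_L[\phi](\lambda),\qquad F[M\phi](\lambda)=\omega_M(\lambda)F[\phi](\lambda)+R_M[\phi](\lambda),$$ where $$\omega_L(\lambda)=\begin{cases}i\lambda&\lambda\in\mathbb R,\\ \frac i\lambda&\lambda\in\mathcal C,\end{cases}\qquad \omega_M(\lambda)=\begin{cases}1+\lambda^2&\lambda\in\mathbb R,\\ 1+\frac1{\lambda^2}&\lambda\in\mathcal C.\end{cases}$$ Moreover, if $q:[0,\infty)\times[0,T]\to\mathbb C$ is sufficiently smooth in the sense given in the context and $q(\cdot,t)\in\operatorname{Dom}L=\operatorname{Dom}M$ for all $t\in[0,T]$, then, for all $t\in[0,T]$ and all $x\in(0,\infty)$, $$F^{-1}\left[\lambda\mapsto\int_0^te^{(s-t)\omega(\lambda)}\,\frac{R_L[q](\lambda;s)+R_M[q_t](\lambda;s)}{\omega_M(\lambda)}\,ds\right](x)=0,$$ where $\omega(\lambda)=\omega_L(\lambda)/\omega_M(\lambda)=i\lambda/(1+\lambda^2)$,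 $R_L[q](\lambda;s)=R_L[q(\cdot,s)](\lambda)$ and $R_M[q_t](\lambda;s)=R_M[\partial_tq(\cdot,s)](\lambda)$.
   Context: $T>0$. $\mathcal S[0,\infty)$ is the space of (complex valued) smooth functions on $[0,\infty)$ (smooth up to $0$) which decay rapidly at infinity along with all of their derivatives, with its usual Fréchet topology given by the seminorms $\sup_{x\geq0}|x^j\phi^{(k)}(x)|$, $j,k\geq0$. $\mathcal C$ is a small positively oriented (piecewise smooth) simple closed contour enclosing the point $\lambda=i$; "small" means that $\mathcal C$ lies in the open upper half plane $\mathbb C^+$. The contour $\mathbb R$ is oriented in the increasing sense. For $\phi\in\mathcal S[0,\infty)$, $$F[\phi](\lambda)=\begin{cases}\int_0^\infty e^{-i\lambda y}\phi(y)\,dy&\lambda\in\mathbb R,\\ -\frac1{\lambda^2}\int_0^\infty e^{-\frac{i}{\lambda}y}\phi(y)\,dy&\lambda\in\mathcal C,\end{cases}\qquad F^{-1}[f](x)=\frac1{2\pi}\int_{\mathbb R\cup\mathcal C}e^{i\lambda x}f(\lambda)\,d\lambda ,$$ where $\int_{\mathbb R\cup\mathcal C}=\int_{\mathbb R}+\int_{\mathcal C}$ and the integral over $\mathbb R$ is improper, understood as $\lim_{N\to\infty}\int_{-N}^N$. "$q$ sufficiently smooth" means: $t\mapsto q(\cdot,t)$ is a continuously differentiable map from $[0,T]$ into $\mathcal S[0,\infty)$; its derivative is $\partial_tq(\cdot,t)=q_t(\cdot,t)$ (which then also belongs to $\operatorname{Dom}M$ when $q(\cdot,t)\in\operatorname{Dom}M$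 for all $t$). *)

theory Defs
  imports "HOL-Complex_Analysis.Complex_Analysis"
begin

text \<open>
  A function on \<open>[0,\<infinity>)\<close> is represented by a total function on the reals whose values at
  negative arguments are irrelevant: everything below only looks at arguments \<open>x \<ge> 0\<close>, and the
  derivatives are taken within \<open>[0,\<infinity>)\<close>, hence are one-sided at \<open>0\<close>.
\<close>

primrec nderiv :: "nat \<Rightarrow> (real \<Rightarrow> complex) \<Rightarrow> real \<Rightarrow> complex" where
  "nderiv 0 \<phi> = \<phi>"
| "nderiv (Suc k) \<phi> = (\<lambda>x. vector_derivative (nderiv k \<phi>) (at x within {0..}))"

definition schwartz :: "(real \<Rightarrow> complex) set" where
  "schwartz = {\<phi>. (\<forall>k. \<forall>x\<ge>0. nderiv k \<phi> differentiable (at x within {0..})) \<and>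
     (\<forall>j k. bdd_above ((\<lambda>x. cmod (of_real (x ^ j) * nderiv k \<phi> x)) ` {0..}))}"

definition schwartz_seminorm :: "nat \<Rightarrow> nat \<Rightarrow> (real \<Rightarrow> complex) \<Rightarrow> real" where
  "schwartz_seminorm j k \<phi> = (SUP x\<in>{0..}. cmod (of_real (x ^ j) * nderiv k \<phi> x))"

text \<open>Convergence in the topology generated by the seminorms; meant for \<open>u s\<close> and \<open>l\<close> in
  \<^const>\<open>schwartz\<close>, where the suprema are finite.\<close>

definition schwartz_tendsto ::
    "('b \<Rightarrow> real \<Rightarrow> complex) \<Rightarrow> (real \<Rightarrow> complex) \<Rightarrow> 'b filter \<Rightarrow> bool" where
  "schwartz_tendsto u l net \<longleftrightarrow>
     (\<forall>j k. ((\<lambda>s. schwartz_seminorm j k (\<lambda>x. u s x - l x)) \<longlongrightarrow> 0) net)"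

text \<open>The map \<open>t \<mapsto> q(\<cdot>,t)\<close> is continuously differentiable from \<open>[0,T]\<close> into
  \<^const>\<open>schwartz\<close>, with derivative \<open>t \<mapsto> q'(\<cdot>,t)\<close> (which is determined by \<open>q\<close> on
  \<open>[0,\<infinity>) \<times> [0,T]\<close> when \<open>T > 0\<close>).\<close>

definition schwartz_C1 ::
    "real \<Rightarrow> (real \<Rightarrow> real \<Rightarrow> complex) \<Rightarrow> (real \<Rightarrow> real \<Rightarrow> complex) \<Rightarrow> bool" where
  "schwartz_C1 T q q' \<longleftrightarrow> (\<forall>t\<in>{0..T}.
     (\<lambda>x. q x t) \<in> schwartz \<and> (\<lambda>x. q' x t) \<in> schwartz \<and>
     schwartz_tendsto (\<lambda>s x. (q x s - q x t) /\<^sub>R (s - t)) (\<lambda>x. q' x t) (at t within {0..T}) \<and>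
     schwartz_tendsto (\<lambda>s x. q' x s) (\<lambda>x. q' x t) (at t within {0..T}))"

definition Dom :: "(real \<Rightarrow> complex) set" where
  "Dom = {\<phi> \<in> schwartz. \<phi> 0 = 0}"

definition L_op :: "(real \<Rightarrow> complex) \<Rightarrow> real \<Rightarrow> complex" where
  "L_op \<phi> = nderiv 1 \<phi>"

definition M_op :: "(real \<Rightarrow> complex) \<Rightarrow> real \<Rightarrow> complex" where
  "M_op \<phi> = (\<lambda>x. \<phi> x - nderiv 2 \<phi> x)"

definition admissible_contour :: "(real \<Rightarrow> complex) \<Rightarrow> bool" where
  "admissible_contour \<gamma> \<longleftrightarrow>
     valid_path \<gamma> \<and> simple_path \<gamma> \<and> pathfinish \<gamma> = pathstart \<gamma> \<and>
     path_image \<gamma> \<subseteq> {z. Im z > 0} \<and>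
     \<i> \<in> inside (path_image \<gamma>) \<and>
     (\<forall>z\<in>inside (path_image \<gamma>). winding_number \<gamma> z = 1)"

text \<open>The functions below are used on \<open>\<real> \<union> path_image \<gamma>\<close> only, with \<open>\<gamma>\<close> an admissible
  contour. As its image is disjoint from \<open>\<real>\<close>, the case \<open>z \<in> path_image \<gamma>\<close> is the
  \<open>else\<close> branch.\<close>

definition F_trans :: "(real \<Rightarrow> complex) \<Rightarrow> complex \<Rightarrow> complex" where
  "F_trans \<phi> z =
     (if z \<in> \<real> then integral {0..} (\<lambda>y. exp (- \<i> * z * of_real y) * \<phi> y)
      else - (1 / z\<^sup>2) * integral {0..} (\<lambda>y. exp (- (\<i> / z) * of_real y) * \<phi> y))"

definition omega_L :: "complex \<Rightarrow> complex" where
  "omega_L z = (if z \<in> \<real> then \<i> * z else \<i> / z)"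

definition omega_M :: "complex \<Rightarrow> complex" where
  "omega_M z = (if z \<in> \<real> then 1 + z\<^sup>2 else 1 + 1 / z\<^sup>2)"

definition omega :: "complex \<Rightarrow> complex" where
  "omega z = omega_L z / omega_M z"

lemma omega_eq: "omega z = \<i> * z / (1 + z\<^sup>2)"
proof (cases "z \<in> \<real>")
  case True
  then show ?thesis by (simp add: omega_def omega_L_def omega_M_def)
next
  case False
  then have "z \<noteq> 0" by auto
  then have "1 + 1 / z\<^sup>2 = (1 + z\<^sup>2) / z\<^sup>2" by (simp add: field_simps)
  with False \<open>z \<noteq> 0\<close> show ?thesis
    by (simp add: omega_def omega_L_def omega_M_def power2_eq_square)
qed

text \<open>The inverse transform, with the integral over the real line taken as the limit of the
  integrals over \<open>[-N,N]\<close>, and the assertion that all integrals and the limit in it exist.\<close>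

definition F_inv_exists :: "(real \<Rightarrow> complex) \<Rightarrow> (complex \<Rightarrow> complex) \<Rightarrow> real \<Rightarrow> bool" where
  "F_inv_exists \<gamma> f x \<longleftrightarrow>
     (\<forall>N. (\<lambda>l. exp (\<i> * of_real l * of_real x) * f (of_real l)) integrable_on {-N..N}) \<and>
     (\<exists>v. ((\<lambda>N. integral {-N..N} (\<lambda>l. exp (\<i> * of_real l * of_real x) * f (of_real l)))
            \<longlongrightarrow> v) at_top) \<and>
     (\<lambda>z. exp (\<i> * z * of_real x) * f z) contour_integrable_on \<gamma>"

definition F_inv :: "(real \<Rightarrow> complex) \<Rightarrow> (complex \<Rightarrow> complex) \<Rightarrow> real \<Rightarrow> complex" where
  "F_inv \<gamma> f x = 1 / (2 * of_real pi) *
     (Lim at_top (\<lambda>N::real. integral {-N..N}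
        (\<lambda>l. exp (\<i> * of_real l * of_real x) * f (of_real l))) +
      contour_integral \<gamma> (\<lambda>z. exp (\<i> * z * of_real x) * f z))"

end

theory Submission
  imports Defs "HOL-Real_Asymp.Real_Asymp"
begin

text \<open>
  Integration by parts on the half-line (\<open>integral_exp_nderiv\<close>) computes the remainders: for
  \<open>\<phi> 0 = 0\<close> one finds \<open>R_L \<phi> = 0\<close>, while \<open>R_M \<phi>\<close> is \<open>\<phi>' 0\<close> on the real line and \<open>- \<phi>' 0 / z\<^sup>2\<close> on the
  contour. After division by \<open>omega_M\<close> these become \<open>\<phi>' 0 / (1 + z\<^sup>2)\<close> and \<open>- \<phi>' 0 / (1 + z\<^sup>2)\<close>: one and
  the same rational function, with opposite signs on the two parts of the contour.

  Hence, with \<open>h s = \<partial>\<^sub>x q\<^sub>t (0, s)\<close> and the entire function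
  \<open>E w = \<integral>\<^sub>0\<^sup>t exp ((s - t) w) * h s ds\<close> (\<open>holomorphic_exponential_integral\<close>), the inverse transform
  in question is, up to the factor \<open>1 / (2 \<pi>)\<close>, the difference of the integrals of
  \<open>f z = exp (\<i> z x) * E (\<i> z / (1 + z\<^sup>2)) / (1 + z\<^sup>2)\<close> over the real line and over \<open>\<gamma>\<close>. The function \<open>f\<close> is holomorphic in \<open>Im z > -1\<close> except at \<open>\<i>\<close>, where it
  has an isolated (generally essential) singularity, and it is \<open>O(1 / |z|\<^sup>2)\<close> as \<open>z\<close> tends to infinity
  in the closed upper half plane, since \<open>omega z\<close> tends to \<open>0\<close>. Closing the real line by a large semicircle shows
  that both integrals equal \<open>2 \<pi> \<i>\<close> times the residue of \<open>f\<close> at \<open>\<i>\<close>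
  (\<open>real_line_integral_eq_contour_integral\<close>), so the difference vanishes.
\<close>


section \<open>Integration by parts on the half-line and the remainders\<close>

text \<open>
  Dominated convergence for the truncations \<open>f \<cdot> 1\<^bsub>[0,n]\<^esub>\<close>. It turns integrability on
  every \<open>[0,n]\<close>, which is clear for a continuous \<open>f\<close>, into integrability on the half-line, and it
  carries the fundamental theorem of calculus over to the half-line.
\<close>

lemma integral_halfline_limit:
  fixes f :: "real \<Rightarrow> 'a::euclidean_space" and g :: "real \<Rightarrow> real"
  assumes f: "\<And>n::nat. f integrable_on {0..real n}"
    and g: "g integrable_on {0..}"
    and le: "\<And>x. x \<ge> 0 \<Longrightarrow> norm (f x) \<le> g x"
  shows "f integrable_on {0..}"
    and "(\<lambda>n. integral {0..real n} f) \<longlonglongrightarrow> integral {0..} f"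
proof -
  define F where "F n x = (if x \<in> {0..real n} then f x else 0)" for n x
  have hi: "(F n has_integral integral {0..real n} f) {0..}" for n
    unfolding F_def using f[of n] by (subst has_integral_restrict) (auto simp: integrable_integral)
  have lim: "(\<lambda>n. F n x) \<longlonglongrightarrow> f x" if "x \<in> {0..}" for x
  proof -
    obtain m :: nat where "x \<le> real m" using real_arch_simple by blast
    then have "\<forall>n\<ge>m. F n x = f x" using that by (auto simp: F_def)
    then show ?thesis
      by (intro tendsto_eventually) (auto simp: eventually_at_top_linorder)
  qed
  have dom: "norm (F n x) \<le> g x" if "x \<in> {0..}" for n x
    using le[of x] that norm_ge_zero[of "f x"] order_trans[OF norm_ge_zero le[of x]]
    by (auto simp: F_def)
  have "F n integrable_on {0..}" for n using hi by blast
  note dc = dominated_convergence[OF this g dom lim]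
  show "f integrable_on {0..}" using dc by blast
  have "integral {0..} (F n) = integral {0..real n} f" for n using hi by blast
  then show "(\<lambda>n. integral {0..real n} f) \<longlonglongrightarrow> integral {0..} f"
    using dc by simp
qed

lemma integrable_inverse_square_halfline:
  "(\<lambda>x::real. K / (1 + x)\<^sup>2) integrable_on {0..}"
proof -
  have ftc: "((\<lambda>x. 1 / (1 + x)\<^sup>2) has_integral (- 1 / (1 + y) - (- 1 / (1 + 0)))) {0..y}"
    if "y \<ge> 0" for y :: real
    by (rule fundamental_theorem_of_calculus[OF that])
       (auto intro!: derivative_eq_intros
         simp: has_real_derivative_iff_has_vector_derivative[symmetric] power2_eq_square)
  have "((\<lambda>x::real. 1 / (1 + x)\<^sup>2) has_integral 1) {0..}"
  proof (rule has_integral_to_inf)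
    show "(\<lambda>x. 1 / (1 + x)\<^sup>2) integrable_on {0..y}" for y :: real
      using ftc[of y] by (cases "y \<ge> 0") auto
    have "((\<lambda>y::real. - 1 / (1 + y) - (- 1 / (1 + 0))) \<longlongrightarrow> 1) at_top"
      by real_asymp
    moreover have "eventually (\<lambda>y::real. - 1 / (1 + y) - (- 1 / (1 + 0)) =
        integral {0..y} (\<lambda>x. 1 / (1 + x)\<^sup>2)) at_top"
      using eventually_ge_at_top[of 0] by eventually_elim (rule integral_unique[OF ftc, symmetric])
    ultimately show "((\<lambda>y::real. integral {0..y} (\<lambda>x. 1 / (1 + x)\<^sup>2)) \<longlongrightarrow> 1) at_top"
      by (rule Lim_transform_eventually)
  qed auto
  then have "(\<lambda>x::real. K * (1 / (1 + x)\<^sup>2)) integrable_on {0..}"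
    by (intro integrable_on_mult_right) blast
  then show ?thesis by simp
qed

lemma nderiv_has_vector_derivative:
  assumes "\<phi> \<in> schwartz" "x \<ge> 0"
  shows "(nderiv k \<phi> has_vector_derivative nderiv (Suc k) \<phi> x) (at x within {0..})"
  using assms by (simp add: schwartz_def vector_derivative_works)

text \<open>
  The seminorms with weights \<open>1\<close>, \<open>x\<close> and \<open>x\<^sup>2\<close> together bound \<open>(1 + x)\<^sup>2\<close> times the derivative; this
  is all the decay that the transforms use.
\<close>

lemma schwartz_decay:
  assumes "\<phi> \<in> schwartz"
  obtains K where "\<And>x. x \<ge> 0 \<Longrightarrow> norm (nderiv k \<phi> x) \<le> K / (1 + x)\<^sup>2"
proof -
  have "\<exists>B. \<forall>x\<ge>0. x ^ j * norm (nderiv k \<phi> x) \<le> B" for j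
    using assms unfolding schwartz_def bdd_above_def
    by (force simp: norm_mult norm_power)
  then obtain B where B: "\<And>j x. x \<ge> 0 \<Longrightarrow> x ^ j * norm (nderiv k \<phi> x) \<le> B j" by metis
  have "norm (nderiv k \<phi> x) \<le> (B 0 + 2 * B 1 + B 2) / (1 + x)\<^sup>2" if "x \<ge> 0" for x
  proof -
    have "norm (nderiv k \<phi> x) * (1 + x)\<^sup>2 \<le> B 0 + 2 * B 1 + B 2"
      using B[OF that, of 0] B[OF that, of 1] B[OF that, of 2]
      by (simp add: power2_eq_square algebra_simps)
    moreover have "(1 + x)\<^sup>2 > 0" using that by simp
    ultimately show ?thesis by (simp add: pos_le_divide_eq)
  qed
  then show ?thesis by (rule that)
qed

text \<open>
  Integration by parts. The function \<open>u k y = exp (- \<i> \<mu> y) * nderiv k \<phi> y\<close> has derivative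
  \<open>u (Suc k) - \<i> \<mu> * u k\<close> and vanishes at infinity, because the exponential is bounded by \<open>1\<close> for
  \<open>Im \<mu> \<le> 0\<close>. This covers both branches of the transform: \<open>\<mu> = \<lambda>\<close> on the real line, and
  \<open>\<mu> = 1 / \<lambda>\<close> for \<open>\<lambda>\<close> in the upper half plane.
\<close>

lemma integral_exp_nderiv:
  fixes \<mu> :: complex
  assumes \<phi>: "\<phi> \<in> schwartz" and \<mu>: "Im \<mu> \<le> 0"
  defines "A \<equiv> \<lambda>k. integral {0..} (\<lambda>y. exp (- \<i> * \<mu> * of_real y) * nderiv k \<phi> y)"
  shows "(\<lambda>y. exp (- \<i> * \<mu> * of_real y) * nderiv k \<phi> y) integrable_on {0..}"
    and "A (Suc k) = \<i> * \<mu> * A k - nderiv k \<phi> 0"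
proof -
  define u where "u k y = exp (- \<i> * \<mu> * of_real y) * nderiv k \<phi> y" for k and y :: real
  have exp_le: "norm (exp (- \<i> * \<mu> * of_real y)) \<le> 1" if "y \<ge> 0" for y
    using that \<mu> by (simp add: mult_nonpos_nonneg)
  have deriv: "(u k has_vector_derivative u (Suc k) y - \<i> * \<mu> * u k y) (at y within {0..})"
    if "y \<ge> 0" for k y
    unfolding u_def
    by (rule derivative_eq_intros nderiv_has_vector_derivative[OF \<phi> that]
          has_vector_derivative_real_field | simp add: algebra_simps)+
  have cont: "continuous_on {0..} (u k)" for k
    using deriv by (auto simp: continuous_on_eq_continuous_within
        intro: has_vector_derivative_continuous)
  have int: "u k integrable_on {0..real n}" for k n
    by (intro integrable_continuous_interval continuous_on_subset[OF cont]) auto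
  have "\<exists>K. \<forall>y\<ge>0. norm (u k y) \<le> K / (1 + y)\<^sup>2" for k
  proof -
    obtain K where K: "\<And>y. y \<ge> 0 \<Longrightarrow> norm (nderiv k \<phi> y) \<le> K / (1 + y)\<^sup>2"
      using schwartz_decay[OF \<phi>] by blast
    have "norm (u k y) \<le> 1 * (K / (1 + y)\<^sup>2)" if "y \<ge> 0" for y
      unfolding u_def norm_mult by (intro mult_mono exp_le K that) auto
    then show ?thesis by auto
  qed
  then obtain K where K: "\<And>k y. y \<ge> 0 \<Longrightarrow> norm (u k y) \<le> K k / (1 + y)\<^sup>2" by metis
  have int_u: "u k integrable_on {0..}"
    and lim_u: "(\<lambda>n. integral {0..real n} (u k)) \<longlonglongrightarrow> integral {0..} (u k)" for k
    using integral_halfline_limit[OF int integrable_inverse_square_halfline K] by blast+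
  show "(\<lambda>y. exp (- \<i> * \<mu> * of_real y) * nderiv k \<phi> y) integrable_on {0..}"
    using int_u[of k] by (simp add: u_def[abs_def])
  have ftc: "u k (real n) - u k 0 =
      integral {0..real n} (u (Suc k)) - \<i> * \<mu> * integral {0..real n} (u k)" for n
  proof -
    have "((\<lambda>y. u (Suc k) y - \<i> * \<mu> * u k y) has_integral (u k (real n) - u k 0)) {0..real n}"
      by (rule fundamental_theorem_of_calculus)
        (auto intro!: has_vector_derivative_within_subset[OF deriv])
    moreover have "((\<lambda>y. u (Suc k) y - \<i> * \<mu> * u k y) has_integral
        (integral {0..real n} (u (Suc k)) - \<i> * \<mu> * integral {0..real n} (u k))) {0..real n}"
      by (intro has_integral_diff has_integral_mult_right integrable_integral int)
    ultimately show ?thesis by (rule has_integral_unique)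
  qed
  have "(\<lambda>n. u k (real n)) \<longlonglongrightarrow> 0"
  proof (rule Lim_null_comparison)
    show "eventually (\<lambda>n. norm (u k (real n)) \<le> K k / (1 + real n)\<^sup>2) sequentially"
      using K by (intro always_eventually) auto
    show "(\<lambda>n. K k / (1 + real n)\<^sup>2) \<longlonglongrightarrow> 0" by real_asymp
  qed
  then have "(\<lambda>n. u k (real n) - u k 0) \<longlonglongrightarrow> 0 - u k 0" by (intro tendsto_intros)
  moreover have "(\<lambda>n. u k (real n) - u k 0)
      \<longlonglongrightarrow> integral {0..} (u (Suc k)) - \<i> * \<mu> * integral {0..} (u k)"
    unfolding ftc by (intro tendsto_intros lim_u)
  ultimately have "0 - u k 0 = integral {0..} (u (Suc k)) - \<i> * \<mu> * integral {0..} (u k)"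
    by (rule LIMSEQ_unique)
  then show "A (Suc k) = \<i> * \<mu> * A k - nderiv k \<phi> 0"
    by (simp add: A_def u_def[abs_def] algebra_simps)
qed

text \<open>
  The boundary term \<open>\<phi>' 0\<close> produced by the second integration by parts, multiplied by the prefactor
  of the transform on the respective part of the contour.
\<close>

definition remainder_M :: "(real \<Rightarrow> complex) \<Rightarrow> complex \<Rightarrow> complex" where
  "remainder_M \<phi> z = (if z \<in> \<real> then nderiv 1 \<phi> 0 else - (1 / z\<^sup>2) * nderiv 1 \<phi> 0)"

text \<open>
  The only boundary term of the first integration by parts is \<open>\<phi> 0 = 0\<close>, so \<open>L\<close> has no remainder;
  for \<open>M\<close> the second integration by parts leaves \<open>\<phi>' 0\<close>.
\<close>

lemma F_trans_L_M:
  assumes \<phi>: "\<phi> \<in> Dom" and z: "z \<in> \<real> \<or> Im z > 0"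
  shows "F_trans (L_op \<phi>) z = omega_L z * F_trans \<phi> z"
    and "F_trans (M_op \<phi>) z = omega_M z * F_trans \<phi> z + remainder_M \<phi> z"
proof -
  have \<phi>S: "\<phi> \<in> schwartz" and \<phi>0: "nderiv 0 \<phi> 0 = 0" using \<phi> by (auto simp: Dom_def)
  \<comment> \<open>Both branches of the transform have the form \<open>c * \<integral> exp (- \<i> \<mu> y) * \<psi> y dy\<close> with \<open>Im \<mu> \<le> 0\<close>.\<close>
  define \<mu> where "\<mu> = (if z \<in> \<real> then z else 1 / z)"
  define c where "c = (if z \<in> \<real> then 1 else - (1 / z\<^sup>2))"
  have \<mu>: "Im \<mu> \<le> 0"
    using z by (auto simp: \<mu>_def complex_is_Real_iff Im_divide divide_nonpos_nonneg)
  define A where "A k = integral {0..} (\<lambda>y. exp (- \<i> * \<mu> * of_real y) * nderiv k \<phi> y)" for k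
  have F: "F_trans \<psi> z = c * integral {0..} (\<lambda>y. exp (- \<i> * \<mu> * of_real y) * \<psi> y)" for \<psi>
    by (simp add: F_trans_def c_def \<mu>_def)
  note int = integral_exp_nderiv(1)[OF \<phi>S \<mu>]
  have A1: "A 1 = \<i> * \<mu> * A 0"
    using integral_exp_nderiv(2)[OF \<phi>S \<mu>, of 0] \<phi>0 by (simp add: A_def)
  have A2: "A 2 = \<i> * \<mu> * A 1 - nderiv 1 \<phi> 0"
    using integral_exp_nderiv(2)[OF \<phi>S \<mu>, of 1] by (simp add: A_def numeral_2_eq_2)
  have FM: "F_trans (M_op \<phi>) z = c * (A 0 - A 2)"
    using integral_diff[OF int[of 0] int[of 2]]
    unfolding F M_op_def A_def by (simp add: right_diff_distrib)
  have F0: "F_trans \<phi> z = c * A 0" by (simp add: F A_def)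
  have FL: "F_trans (L_op \<phi>) z = c * A 1" by (simp only: F L_op_def A_def)
  have oL: "omega_L z = \<i> * \<mu>" and oM: "omega_M z = 1 + \<mu>\<^sup>2" and R: "remainder_M \<phi> z = c * nderiv 1 \<phi> 0"
    by (auto simp: omega_L_def omega_M_def \<mu>_def c_def remainder_M_def power_divide)
  show "F_trans (L_op \<phi>) z = omega_L z * F_trans \<phi> z"
    unfolding FL F0 oL A1 by simp
  show "F_trans (M_op \<phi>) z = omega_M z * F_trans \<phi> z + remainder_M \<phi> z"
    unfolding FM F0 oM R A2 A1 by (simp add: algebra_simps power2_eq_square)
qed

text \<open>
  The functional \<open>\<phi> \<mapsto> \<phi>' 0\<close> is continuous in the Schwartz topology, as it is bounded by the
  seminorm with \<open>j = 0\<close> and \<open>k = 1\<close>. The seminorm, a supremum of reals, only bounds anything once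
  the set is known to be bounded; for the difference of two Schwartz functions this follows from
  the linearity of the one-sided derivative.
\<close>

lemma continuous_on_nderiv_at_0:
  assumes qS: "\<And>s. s \<in> I \<Longrightarrow> (\<lambda>x. p x s) \<in> schwartz"
    and lim: "\<And>t. t \<in> I \<Longrightarrow> schwartz_tendsto (\<lambda>s x. p x s) (\<lambda>x. p x t) (at t within I)"
  shows "continuous_on I (\<lambda>s. nderiv 1 (\<lambda>x. p x s) 0)"
  unfolding continuous_on_def
proof
  fix t assume t: "t \<in> I"
  have le: "norm (nderiv 1 (\<lambda>x. p x s) 0 - nderiv 1 (\<lambda>x. p x t) 0)
      \<le> schwartz_seminorm 0 1 (\<lambda>x. p x s - p x t)" if s: "s \<in> I" for s
  proof -
    have eq: "nderiv 1 (\<lambda>x. p x s - p x t) x = nderiv 1 (\<lambda>x. p x s) x - nderiv 1 (\<lambda>x. p x t) x"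
      if "x \<ge> 0" for x
    proof -
      have "at_right x \<le> at x within {0..}" using that by (intro at_le) auto
      then have nt: "at x within {0..} \<noteq> bot"
        using trivial_limit_at_right_real[of x] le_bot by metis
      show ?thesis
        using has_vector_derivative_diff[OF nderiv_has_vector_derivative[OF qS[OF s] that, of 0]
          nderiv_has_vector_derivative[OF qS[OF t] that, of 0]]
        by (simp add: vector_derivative_within[OF nt])
    qed
    obtain K1 K2 where
      K1: "\<And>x. x \<ge> 0 \<Longrightarrow> norm (nderiv 1 (\<lambda>x. p x s) x) \<le> K1" and
      K2: "\<And>x. x \<ge> 0 \<Longrightarrow> norm (nderiv 1 (\<lambda>x. p x t) x) \<le> K2"
    proof -
      have "\<exists>K. \<forall>x\<ge>0. norm (nderiv 1 (\<lambda>x. p x s) x) \<le> K" if "s \<in> I" for s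
      proof -
        have "bdd_above ((\<lambda>x. cmod (of_real (x ^ 0) * nderiv 1 (\<lambda>x. p x s) x)) ` {0..})"
          using qS[OF that] unfolding schwartz_def mem_Collect_eq by (elim conjE allE)
        then show ?thesis unfolding bdd_above_def by auto
      qed
      then show ?thesis using s t that by meson
    qed
    have bdd: "bdd_above ((\<lambda>x. cmod (of_real (x ^ 0) * nderiv 1 (\<lambda>x. p x s - p x t) x)) ` {0..})"
    proof (rule bdd_aboveI2)
      fix x :: real assume "x \<in> {0..}"
      then have x: "x \<ge> 0" by simp
      show "cmod (of_real (x ^ 0) * nderiv 1 (\<lambda>x. p x s - p x t) x) \<le> K1 + K2"
        using norm_triangle_le_diff[OF add_mono[OF K1[OF x] K2[OF x]]] eq[OF x] by simp
    qed
    show ?thesis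
      using cSUP_upper[OF _ bdd, of 0] eq[of 0] unfolding schwartz_seminorm_def by simp
  qed
  have z: "((\<lambda>s. schwartz_seminorm 0 1 (\<lambda>x. p x s - p x t)) \<longlongrightarrow> 0) (at t within I)"
    using lim[OF t] unfolding schwartz_tendsto_def by blast
  have "((\<lambda>s. nderiv 1 (\<lambda>x. p x s) 0 - nderiv 1 (\<lambda>x. p x t) 0) \<longlongrightarrow> 0) (at t within I)"
    by (rule Lim_null_comparison[OF _ z]) (use le in \<open>auto simp: eventually_at_filter\<close>)
  then show "((\<lambda>s. nderiv 1 (\<lambda>x. p x s) 0) \<longlongrightarrow> nderiv 1 (\<lambda>x. p x t) 0) (at t within I)"
    by (rule LIM_zero_cancel)
qed


section \<open>Deforming the real line to the contour\<close>

text \<open>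
  The upper and the lower half of the circle of radius \<open>N\<close> together wind once around \<open>p\<close>. The
  lower half, closed by the diameter, stays in the closed lower half plane and does not wind around
  \<open>p\<close>. Subtracting, the upper half closed by the opposite diameter winds once.
\<close>

lemma winding_number_semicircle:
  assumes p: "Im p > 0" "cmod p < N"
  shows "winding_number (part_circlepath 0 N 0 pi +++ linepath (- of_real N) (of_real N)) p = 1"
    and "p \<notin> path_image (part_circlepath 0 N 0 pi)"
proof -
  define lower where "lower = part_circlepath 0 N pi (2 * pi)"
  have N: "N > 0" using p(2) norm_ge_zero[of p] by linarith
  have off: "p \<notin> path_image (part_circlepath 0 N a b)" for a b
    using path_image_part_circlepath_subset'[of N 0 a b] N p(2) by auto
  then show "p \<notin> path_image (part_circlepath 0 N 0 pi)" .
  have lineIm: "Im z = 0" if "z \<in> closed_segment (of_real a) (of_real b)" for z and a b :: real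
    using that by (auto simp: closed_segment_def)
  have off_line: "p \<notin> closed_segment (- of_real N) (of_real N)"
    "p \<notin> closed_segment (of_real N) (- of_real N)"
    using lineIm[of p "- N" N] lineIm[of p N "- N"] p(1) by auto
  have upper: "subpath 0 (1/2) (circlepath 0 N) = part_circlepath 0 N 0 pi"
    and low: "subpath (1/2) 1 (circlepath 0 N) = lower"
    by (auto simp: subpath_def circlepath_def part_circlepath_def linepath_def lower_def
        fun_eq_iff algebra_simps)
  have "winding_number (part_circlepath 0 N 0 pi) p + winding_number lower p
      = winding_number (subpath 0 1 (circlepath 0 N)) p"
    unfolding upper[symmetric] low[symmetric]
    by (rule winding_number_subpath_combine) (use off in \<open>auto simp: circlepath_def\<close>)
  also have "\<dots> = 1" using p(2) by (simp add: winding_number_circlepath)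
  finally have circ: "winding_number (part_circlepath 0 N 0 pi) p + winding_number lower p = 1" .
  have eN: "exp (\<i> * (2 * of_real pi)) = 1"
    using exp_two_pi_i by (simp add: mult.commute mult.left_commute)
  have fin: "pathfinish lower = of_real N" "pathstart lower = - of_real N"
    "pathfinish (part_circlepath 0 N 0 pi) = - of_real N"
    "pathstart (part_circlepath 0 N 0 pi) = of_real N"
    using exp_pi_i by (simp_all add: lower_def eN mult.commute[of _ \<i>])
  have path_lower: "path lower" by (simp add: lower_def)
  have "winding_number (lower +++ linepath (of_real N) (- of_real N)) p = 0"
  proof (rule winding_number_zero_outside[where s = "{z. Im z \<le> 0}"])
    have "path_image lower \<subseteq> {z. Im z \<le> 0}"
    proof
      fix z assume "z \<in> path_image lower"
      then obtain \<theta> where "z = of_real N * exp (\<i> * of_real \<theta>)" "pi \<le> \<theta>" "\<theta> \<le> 2 * pi"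
        by (auto simp: lower_def path_image_part_circlepath)
      then show "z \<in> {z. Im z \<le> 0}"
        using N sin_le_zero[of \<theta>] by (cases "\<theta> = 2 * pi") (auto simp: Im_exp mult_nonneg_nonpos)
    qed
    moreover have "path_image (linepath (of_real N) (- of_real N)) \<subseteq> {z. Im z \<le> 0}"
      using lineIm[of _ N "- N"] by auto
    ultimately show "path_image (lower +++ linepath (of_real N) (- of_real N)) \<subseteq> {z. Im z \<le> 0}"
      by (simp add: path_image_join fin)
  qed (use p in \<open>auto simp: path_lower fin convex_halfspace_Im_le\<close>)
  then have "winding_number lower p + winding_number (linepath (of_real N) (- of_real N)) p = 0"
    using off off_line by (subst (asm) winding_number_join) (auto simp: path_lower fin lower_def eN)
  moreover have "winding_number (linepath (of_real N) (- of_real N)) p =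
      - winding_number (linepath (- of_real N) (of_real N)) p"
    using off_line winding_number_reversepath[of "linepath (- of_real N) (of_real N)" p] by simp
  ultimately show "winding_number (part_circlepath 0 N 0 pi +++ linepath (- of_real N) (of_real N)) p = 1"
    using circ off off_line by (subst winding_number_join) (auto simp: fin)
qed

text \<open>
  Jordan's argument: the residue theorem on a large half disc. On the arc of radius \<open>N\<close> the
  integrand is \<open>O(1 / N\<^sup>2)\<close> while the length is \<open>\<pi> N\<close>, so the arc does not contribute in the limit.
\<close>

lemma real_line_integral_eq_residue:
  fixes f :: "complex \<Rightarrow> complex"
  assumes S: "open S" "convex S" "{z. Im z \<ge> 0} \<subseteq> S"
    and p: "Im p > 0"
    and f: "f holomorphic_on S - {p}"
    and decay: "\<And>z. \<lbrakk>Im z \<ge> 0; cmod z \<ge> R\<rbrakk> \<Longrightarrow> cmod (f z) \<le> C / (cmod z)\<^sup>2"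
  shows "((\<lambda>N. integral {-N..N} (\<lambda>l. f (of_real l))) \<longlongrightarrow> 2 * of_real pi * \<i> * residue f p) at_top"
proof -
  define arc where "arc N = contour_integral (part_circlepath 0 N 0 pi) f" for N
  have big: "integral {-N..N} (\<lambda>l. f (of_real l)) = 2 * of_real pi * \<i> * residue f p - arc N \<and>
      cmod (arc N) \<le> \<bar>C\<bar> * pi / N" if N: "N > cmod p" "N > R" for N
  proof -
    let ?u = "part_circlepath 0 N 0 pi" and ?l = "linepath (- of_real N) (of_real N) :: real \<Rightarrow> complex"
    have N0: "N > 0" using N(1) norm_ge_zero[of p] by linarith
    have u_im: "Im z \<ge> 0" "cmod z = N" if "z \<in> path_image ?u" for z
    proof -
      from that obtain \<theta> where \<theta>: "z = of_real N * exp (\<i> * of_real \<theta>)" "0 \<le> \<theta>" "\<theta> \<le> pi"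
        by (auto simp: path_image_part_circlepath)
      show "Im z \<ge> 0" "cmod z = N" 
        using \<theta> N0 sin_ge_zero[of \<theta>] by (auto simp: Im_exp norm_mult)
    qed
    have l_im: "Im z = 0" if "z \<in> path_image ?l" for z
      using that by (auto simp: closed_segment_def)
    have sub_u: "path_image ?u \<subseteq> S - {p}"
      using u_im(1) S(3) winding_number_semicircle(2)[OF p N(1)] by blast
    have sub_l: "path_image ?l \<subseteq> S - {p}"
      using l_im S(3) p by force
    have cont: "continuous_on (S - {p}) f" using f by (rule holomorphic_on_imp_continuous_on)
    have int_u: "f contour_integrable_on ?u"
      by (intro contour_integrable_continuous_part_circlepath continuous_on_subset[OF cont] sub_u)
    have int_l: "f contour_integrable_on ?l"
      using sub_l by (intro contour_integrable_continuous_linepath continuous_on_subset[OF cont]) simp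
    have fin: "pathfinish ?u = - of_real N" "pathstart ?u = of_real N"
      using exp_pi_i by (simp_all add: mult.commute)
    have img: "path_image (?u +++ ?l) \<subseteq> S - {p}"
      using sub_u sub_l by (subst path_image_join) (simp_all add: fin)
    have vp: "valid_path (?u +++ ?l)" by (intro valid_path_join) (simp_all add: fin)
    have "contour_integral (?u +++ ?l) f =
        of_real (2 * pi) * \<i> * (\<Sum>w\<in>{p}. winding_number (?u +++ ?l) w * residue f w)"
    proof (rule Residue_theorem[OF S(1) convex_connected[OF S(2)] _ f vp _ img])
      show "\<forall>z. z \<notin> S \<longrightarrow> winding_number (?u +++ ?l) z = 0"
        using winding_number_zero_outside[OF valid_path_imp_path[OF vp] S(2)] img
        by (auto simp: fin)
    qed (simp_all add: fin)
    also have "\<dots> = 2 * of_real pi * \<i> * residue f p"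
      using winding_number_semicircle(1)[OF p N(1)] by simp
    finally have "contour_integral ?u f + contour_integral ?l f = 2 * of_real pi * \<i> * residue f p"
      by (subst (asm) contour_integral_join) (simp_all add: int_u int_l fin)
    moreover have "contour_integral ?l f = integral {-N..N} (\<lambda>l. f (of_real l))"
      using N0 by (subst contour_integral_linepath_Reals_eq) auto
    moreover have "cmod (contour_integral ?u f) \<le> (\<bar>C\<bar> / N\<^sup>2) * N * \<bar>pi - 0\<bar>"
    proof (rule contour_integral_bound_part_circlepath[OF int_u])
      fix z assume "z \<in> path_image ?u"
      with decay[of z] u_im[of z] N have "cmod (f z) \<le> C / N\<^sup>2" by simp
      also have "\<dots> \<le> \<bar>C\<bar> / N\<^sup>2" by (intro divide_right_mono) auto
      finally show "cmod (f z) \<le> \<bar>C\<bar> / N\<^sup>2" .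
    qed (use N0 in auto)
    ultimately show ?thesis
      using N0 by (auto simp: arc_def power2_eq_square algebra_simps)
  qed
  have ev: "eventually (\<lambda>N. N > cmod p \<and> N > R) at_top"
    by (intro eventually_conj eventually_gt_at_top)
  have "(arc \<longlongrightarrow> 0) at_top"
  proof (rule Lim_null_comparison)
    show "eventually (\<lambda>N. norm (arc N) \<le> \<bar>C\<bar> * pi / N) at_top"
      using ev by eventually_elim (use big in auto)
    show "((\<lambda>N. \<bar>C\<bar> * pi / N) \<longlongrightarrow> 0) at_top" by real_asymp
  qed
  then have "((\<lambda>N. 2 * of_real pi * \<i> * residue f p - arc N) \<longlongrightarrow> 2 * of_real pi * \<i> * residue f p - 0) at_top"
    by (intro tendsto_intros)
  then have "((\<lambda>N. 2 * of_real pi * \<i> * residue f p - arc N) \<longlongrightarrow> 2 * of_real pi * \<i> * residue f p) at_top"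
    by simp
  moreover have "eventually (\<lambda>N. 2 * of_real pi * \<i> * residue f p - arc N =
      integral {-N..N} (\<lambda>l. f (of_real l))) at_top"
    using ev by eventually_elim (use big in auto)
  ultimately show ?thesis by (rule Lim_transform_eventually)
qed

lemma one_plus_square_nonzero:
  assumes "Im z > -1" "z \<noteq> \<i>" shows "1 + z\<^sup>2 \<noteq> 0"
proof
  assume "1 + z\<^sup>2 = 0"
  then have "(z - \<i>) * (z + \<i>) = 0" by (simp add: algebra_simps power2_eq_square)
  then have "z = \<i> \<or> z = - \<i>" by (simp only: mult_eq_0_iff right_minus_eq eq_neg_iff_add_eq_0)
  then show False using assms by auto
qed

text \<open>
  The singularity of \<open>E (\<i> z / (1 + z\<^sup>2))\<close> at \<open>\<i>\<close> is essential in general, and neither integral is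
  evaluated: both are compared with the residue there. The point \<open>\<i>\<close> is the only singularity
  in a neighbourhood of the closed upper half plane, and the real line (closed by a large arc) and
  the contour \<open>\<gamma>\<close> both wind around it exactly once. Decay at infinity holds because
  \<open>\<i> z / (1 + z\<^sup>2)\<close> tends to \<open>0\<close>, so that \<open>E\<close> stays bounded there.
\<close>

lemma real_line_integral_eq_contour_integral:
  fixes E :: "complex \<Rightarrow> complex" and x :: real
  assumes \<gamma>: "admissible_contour \<gamma>" and E: "E holomorphic_on UNIV" and x: "x \<ge> 0"
  defines "f \<equiv> \<lambda>z. exp (\<i> * z * of_real x) * (E (\<i> * z / (1 + z\<^sup>2)) / (1 + z\<^sup>2))"
  shows "f holomorphic_on {z. Im z > -1} - {\<i>}"
    and "f contour_integrable_on \<gamma>"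
    and "((\<lambda>N. integral {-N..N} (\<lambda>l. f (of_real l))) \<longlongrightarrow> contour_integral \<gamma> f) at_top"
proof -
  let ?S = "{z. Im z > -1}"
  have S: "open ?S" "convex ?S" by (auto simp: open_halfspace_Im_gt convex_halfspace_Im_gt)
  have nz: "1 + z\<^sup>2 \<noteq> 0" if "z \<in> ?S - {\<i>}" for z
    using that by (intro one_plus_square_nonzero) auto
  have comp: "(\<lambda>z. E (\<i> * z / (1 + z\<^sup>2))) holomorphic_on ?S - {\<i>}"
    by (rule holomorphic_on_compose_gen[OF _ E, unfolded o_def])
       (use nz in \<open>auto intro!: holomorphic_intros\<close>)
  show hol: "f holomorphic_on ?S - {\<i>}"
    unfolding f_def by (intro holomorphic_intros comp nz)
  have vp: "valid_path \<gamma>" and cl: "pathfinish \<gamma> = pathstart \<gamma>"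
    and im: "path_image \<gamma> \<subseteq> {z. Im z > 0}" and ins: "\<i> \<in> inside (path_image \<gamma>)"
    and wn: "winding_number \<gamma> \<i> = 1"
    using \<gamma> by (auto simp: admissible_contour_def)
  have img: "path_image \<gamma> \<subseteq> ?S - {\<i>}"
    using im ins by (auto simp: inside_def)
  show "f contour_integrable_on \<gamma>"
    by (rule contour_integrable_holomorphic_simple[OF hol _ vp img]) (intro open_delete S)
  have "contour_integral \<gamma> f = of_real (2 * pi) * \<i> * (\<Sum>w\<in>{\<i>}. winding_number \<gamma> w * residue f w)"
  proof (rule Residue_theorem[OF S(1) convex_connected[OF S(2)] _ hol vp cl img])
    show "\<forall>z. z \<notin> ?S \<longrightarrow> winding_number \<gamma> z = 0"
      using winding_number_zero_outside[OF valid_path_imp_path[OF vp] S(2) cl] img by blast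
  qed simp
  then have res: "contour_integral \<gamma> f = 2 * of_real pi * \<i> * residue f \<i>" using wn by simp
  \<comment> \<open>For \<open>cmod z \<ge> 2\<close> the argument of \<open>E\<close> lies in the unit disc.\<close>
  have "compact (E ` cball 0 1)"
    by (intro compact_continuous_image holomorphic_on_imp_continuous_on
        holomorphic_on_subset[OF E]) auto
  then obtain B where B: "\<And>w. cmod w \<le> 1 \<Longrightarrow> cmod (E w) \<le> B"
  proof -
    have "bounded (E ` cball 0 1)" using \<open>compact (E ` cball 0 1)\<close> by (rule compact_imp_bounded)
    then obtain b where "\<forall>w\<in>E ` cball 0 1. cmod w \<le> b" unfolding bounded_iff by blast
    then show ?thesis by (intro that) auto
  qed
  have decay: "cmod (f z) \<le> (2 * B) / (cmod z)\<^sup>2" if z: "Im z \<ge> 0" "cmod z \<ge> 2" for z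
  proof -
    have z2: "(cmod z)\<^sup>2 \<ge> 2 * cmod z" unfolding power2_eq_square using z by (intro mult_right_mono) auto
    have "cmod (z\<^sup>2) - cmod 1 \<le> cmod (1 + z\<^sup>2)" 
      using norm_diff_ineq[of "z\<^sup>2" 1] by (simp add: add.commute)
    then have low: "cmod (1 + z\<^sup>2) \<ge> (cmod z)\<^sup>2 - 1" by (simp add: norm_power)
    then have low1: "cmod (1 + z\<^sup>2) \<ge> cmod z" and low2: "cmod (1 + z\<^sup>2) \<ge> (cmod z)\<^sup>2 / 2"
      using z2 z by linarith+
    have "cmod (\<i> * z / (1 + z\<^sup>2)) \<le> 1"
      using low1 z by (simp add: norm_divide norm_mult divide_le_eq_1)
    then have E_le: "cmod (E (\<i> * z / (1 + z\<^sup>2))) \<le> B" by (rule B)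
    have B0: "B \<ge> 0" using order_trans[OF norm_ge_zero B[of 0]] by simp
    have "cmod (f z) = exp (- Im z * x) * (cmod (E (\<i> * z / (1 + z\<^sup>2))) / cmod (1 + z\<^sup>2))"
      by (simp add: f_def norm_mult norm_divide)
    also have "\<dots> \<le> 1 * (B / ((cmod z)\<^sup>2 / 2))"
    proof (intro mult_mono frac_le)
      show "exp (- Im z * x) \<le> 1" using z x by (simp add: mult_nonneg_nonneg)
      have "cmod z > 0" using z by linarith
      then show "0 < (cmod z)\<^sup>2 / 2" by simp
    qed (use low2 E_le B0 in simp_all)
    finally show ?thesis by (simp add: mult.commute)
  qed
  show "((\<lambda>N. integral {-N..N} (\<lambda>l. f (of_real l))) \<longlongrightarrow> contour_integral \<gamma> f) at_top"
    unfolding res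
    by (rule real_line_integral_eq_residue[OF S _ _ hol decay]) auto
qed

text \<open>
  The time integral enters the inverse transform as this function at \<open>w = omega z\<close>. Treating it as
  a function of \<open>w\<close> first lets one differentiate under the integral over the convex set of all
  \<open>w\<close>; the plane without the poles of \<open>omega\<close> is not convex.
\<close>

lemma holomorphic_exponential_integral:
  fixes h :: "real \<Rightarrow> complex"
  assumes h: "continuous_on {0..t} h"
  shows "(\<lambda>w. integral {0..t} (\<lambda>s. exp (of_real (s - t) * w) * h s)) holomorphic_on UNIV"
proof -
  have h': "continuous_on (UNIV \<times> {0..t}) (\<lambda>z::complex \<times> real. h (snd z))"
    by (rule continuous_on_compose2[OF h]) (auto intro: continuous_intros)
  have "(\<lambda>w. integral (cbox 0 t) (\<lambda>s. exp (of_real (s - t) * w) * h s)) holomorphic_on UNIV"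
  proof (rule leibniz_rule_holomorphic[where
        fx = "\<lambda>w s. of_real (s - t) * exp (of_real (s - t) * w) * h s"])
    show "((\<lambda>w. exp (of_real (s - t) * w) * h s) has_field_derivative
        of_real (s - t) * exp (of_real (s - t) * w) * h s) (at w within UNIV)" for w s
      by (auto intro!: derivative_eq_intros)
    show "(\<lambda>s. exp (of_real (s - t) * w) * h s) integrable_on cbox 0 t" for w
      unfolding cbox_interval by (intro integrable_continuous_interval continuous_intros h)
    show "continuous_on (UNIV \<times> cbox 0 t)
        (\<lambda>(w, s). of_real (s - t) * exp (of_real (s - t) * w) * h s)"
      unfolding case_prod_unfold cbox_interval by (intro continuous_intros h')
  qed auto
  then show ?thesis by simp
qed


section \<open>The remainder does not contribute to the inverse transform\<close>

theorem theorem8: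
  fixes T :: real and \<gamma> :: "real \<Rightarrow> complex"
  assumes "T > 0" and "admissible_contour \<gamma>"
  shows "\<exists>R_L R_M :: (real \<Rightarrow> complex) \<Rightarrow> complex \<Rightarrow> complex.
    (\<forall>z\<in>\<real> \<union> path_image \<gamma>. \<forall>\<phi>\<in>Dom.
       F_trans (L_op \<phi>) z = omega_L z * F_trans \<phi> z + R_L \<phi> z \<and>
       F_trans (M_op \<phi>) z = omega_M z * F_trans \<phi> z + R_M \<phi> z) \<and>
    (\<forall>(q :: real \<Rightarrow> real \<Rightarrow> complex) q_t.
       schwartz_C1 T q q_t \<longrightarrow> (\<forall>t\<in>{0..T}. (\<lambda>x. q x t) \<in> Dom) \<longrightarrow>
       (\<forall>t\<in>{0..T}. \<forall>x>0.
          let g = (\<lambda>z s. exp (of_real (s - t) * omega z) *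
                     ((R_L (\<lambda>y. q y s) z + R_M (\<lambda>y. q_t y s) z) / omega_M z))
          in (\<forall>z\<in>\<real> \<union> path_image \<gamma>. g z integrable_on {0..t}) \<and>
             F_inv_exists \<gamma> (\<lambda>z. integral {0..t} (g z)) x \<and>
             F_inv \<gamma> (\<lambda>z. integral {0..t} (g z)) x = 0))"
proof (rule exI[of _ "\<lambda>_ _. 0"], rule exI[of _ remainder_M], intro conjI ballI allI impI)
  have im: "Im z > 0" if "z \<in> path_image \<gamma>" for z
    using assms(2) that by (auto simp: admissible_contour_def)
  {
    fix z \<phi> assume "z \<in> \<real> \<union> path_image \<gamma>" "\<phi> \<in> Dom"
    then have "\<phi> \<in> Dom" "z \<in> \<real> \<or> Im z > 0" using im by auto
    note F_trans_L_M[OF this]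
    then show "F_trans (L_op \<phi>) z = omega_L z * F_trans \<phi> z + 0"
      and "F_trans (M_op \<phi>) z = omega_M z * F_trans \<phi> z + remainder_M \<phi> z"
      by simp_all
  next
    fix q q_t :: "real \<Rightarrow> real \<Rightarrow> complex" and t x :: real
    assume C1: "schwartz_C1 T q q_t" and t: "t \<in> {0..T}" and x: "x > 0"
    define h where "h s = nderiv 1 (\<lambda>y. q_t y s) 0" for s
    define E where "E w = integral {0..t} (\<lambda>s. exp (of_real (s - t) * w) * h s)" for w
    define f where "f z = exp (\<i> * z * of_real x) * (E (\<i> * z / (1 + z\<^sup>2)) / (1 + z\<^sup>2))" for z
    \<comment> \<open>The integrand of the inverse transform is \<open>\<epsilon> z * f z\<close>: opposite signs on the line and on \<open>\<gamma>\<close>.\<close>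
    define \<epsilon> :: "complex \<Rightarrow> complex" where "\<epsilon> z = (if z \<in> \<real> then 1 else - 1)" for z
    define g where "g z s = exp (of_real (s - t) * omega z) *
        ((0 + remainder_M (\<lambda>y. q_t y s) z) / omega_M z)" for z s
    have "continuous_on {0..T} h"
      unfolding h_def using C1 by (intro continuous_on_nderiv_at_0) (auto simp: schwartz_C1_def)
    then have h: "continuous_on {0..t} h" using t by (auto intro: continuous_on_subset)
    have E: "E holomorphic_on UNIV"
      unfolding E_def by (rule holomorphic_exponential_integral[OF h])
    note f_props = real_line_integral_eq_contour_integral[OF assms(2) E less_imp_le[OF x],
        folded f_def]

    have g: "g z = (\<lambda>s. (exp (of_real (s - t) * omega z) * h s) * (\<epsilon> z / (1 + z\<^sup>2)))" for z
    proof -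
      have "1 + 1 / z\<^sup>2 = (1 + z\<^sup>2) / z\<^sup>2" if "z \<notin> \<real>"
        using that by (subst add_divide_distrib) auto
      then have "remainder_M (\<lambda>y. q_t y s) z / omega_M z = h s * (\<epsilon> z / (1 + z\<^sup>2))" for s
        by (auto simp: remainder_M_def omega_M_def \<epsilon>_def h_def)
      then show ?thesis by (simp add: g_def fun_eq_iff)
    qed
    have g_int: "g z integrable_on {0..t}" for z
      unfolding g by (intro integrable_continuous_interval continuous_intros h)
    have "integral {0..t} (g z) = E (omega z) * (\<epsilon> z / (1 + z\<^sup>2))" for z
      unfolding g E_def by (rule integral_mult_left)
    then have inner: "exp (\<i> * z * of_real x) * integral {0..t} (g z) = \<epsilon> z * f z" for z
      by (simp add: f_def omega_eq)
    have line: "exp (\<i> * of_real l * of_real x) * integral {0..t} (g (of_real l)) = f (of_real l)"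
      for l :: real
      by (simp add: inner \<epsilon>_def)
    have contour: "- f z = exp (\<i> * z * of_real x) * integral {0..t} (g z)"
      if "z \<in> path_image \<gamma>" for z
      using im[OF that] by (auto simp: inner \<epsilon>_def complex_is_Real_iff)

    have f_line: "(\<lambda>l. f (of_real l)) integrable_on {-N..N}" for N
      by (intro integrable_continuous_interval continuous_on_compose2[OF
            holomorphic_on_imp_continuous_on[OF f_props(1)]] continuous_intros)
         (auto simp: complex_eq_iff)
    have neg: "(\<lambda>z. - f z) contour_integrable_on \<gamma>"
      using f_props(2) by (rule contour_integrable_neg)
    have exists: "F_inv_exists \<gamma> (\<lambda>z. integral {0..t} (g z)) x"
      unfolding F_inv_exists_def line
      using f_line f_props(3) contour_integrable_eq[OF neg contour] by auto
    have "contour_integral \<gamma> (\<lambda>z. exp (\<i> * z * of_real x) * integral {0..t} (g z))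
        = contour_integral \<gamma> (\<lambda>z. - f z)"
      by (rule contour_integral_eq) (simp add: contour)
    also have "\<dots> = - contour_integral \<gamma> f" by (rule contour_integral_neg)
    finally have "F_inv \<gamma> (\<lambda>z. integral {0..t} (g z)) x = 0"
      unfolding F_inv_def line using tendsto_Lim[OF _ f_props(3)] by simp
    with exists g_int show "let g = (\<lambda>z s. exp (of_real (s - t) * omega z) *
          ((0 + remainder_M (\<lambda>y. q_t y s) z) / omega_M z))
        in (\<forall>z\<in>\<real> \<union> path_image \<gamma>. g z integrable_on {0..t}) \<and>
           F_inv_exists \<gamma> (\<lambda>z. integral {0..t} (g z)) x \<and>
           F_inv \<gamma> (\<lambda>z. integral {0..t} (g z)) x = 0"
      by (simp add: Let_def g_def[abs_def])
  }
qed

end
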